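(* Let $Y$ be any sequence space and suppose that the entries of the infinite complex matrices $A=(a_{nk})_{n,k\ge1}$ and $M=(m_{nk})_{n,k\ge1}$ are connected by the relation $$m_{nk}=n^{-1}a_{nk}-(n-1)^{-1}a_{n-1,k}\qquad\text{for all }k,n\ge1,$$ where for $n=1$ this is read as $m_{1k}=a_{1k}$. Then $A\in(Y:d(bv))$ if and only if $M\in(Y:\ell_1)$.
   Context: All sequences are complex sequences $x=(x_k)_{k\ge 1}$; $\omega$ is the space of all of them; a sequence space is a linear subspace of $\omega$. $d(bv)=\{x\in\omega:\sum_{k\ge1}|k^{-1}x_k-(k-1)^{-1}x_{k-1}|<\infty\}$, where the term for $k=1$ is read as $|x_1|$. For sequence spaces $X,Y$, $(X:Y)$ denotes the class of infinite matrices $A=(a_{nk})$ such that for every $x\in X$ the series $(Ax)_n=\sum_k a_{nk}x_k$ converges for each $n$ and $Ax=((Ax)_n)_n\in Y$. *)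

theory Defs
  imports "HOL-Analysis.Analysis" "HOL-Library.Function_Algebras"
begin

text \<open>
  A sequence \<open>(x\<^sub>k)\<close> with \<open>k \<ge> 1\<close> is a function on \<^typ>\<open>nat\<close> whose value at the unused
  index \<open>0\<close> is normalised to \<open>0\<close>, so that distinct functions in \<open>omega\<close> are distinct sequences.
  Matrices are functions of two indices of which only the entries with both indices at least \<open>1\<close>
  are ever used; no normalisation is imposed on the others.
\<close>

definition omega :: "(nat \<Rightarrow> complex) set" where
  "omega = {x. x 0 = 0}"

definition seq_scale :: "complex \<Rightarrow> (nat \<Rightarrow> complex) \<Rightarrow> nat \<Rightarrow> complex" where
  "seq_scale c x = (\<lambda>k. c * x k)"

global_interpretation seq: vector_space seq_scale
  by unfold_locales (auto simp: seq_scale_def fun_eq_iff algebra_simps)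

text \<open>\<open>seq.subspace\<close> is the library's notion of linear subspace, with complex scalars.\<close>

definition sequence_space :: "(nat \<Rightarrow> complex) set \<Rightarrow> bool" where
  "sequence_space Y \<longleftrightarrow> Y \<subseteq> omega \<and> seq.subspace Y"

definition ell1 :: "(nat \<Rightarrow> complex) set" where
  "ell1 = {x \<in> omega. (\<lambda>k. cmod (x k)) summable_on {1..}}"

definition d_bv :: "(nat \<Rightarrow> complex) set" where
  "d_bv = {x \<in> omega.
     (\<lambda>k. cmod (if k = 1 then x 1
                else inverse (of_nat k) * x k - inverse (of_nat (k - 1)) * x (k - 1)))
       summable_on {1..}}"

text \<open>
  The row series may converge only conditionally, so they are ordered series (\<^const>\<open>summable\<close>,
  \<^const>\<open>suminf\<close>); summation starts at index \<open>1\<close>, hence the shift by \<^const>\<open>Suc\<close>.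
\<close>

definition row_convergent :: "(nat \<Rightarrow> nat \<Rightarrow> complex) \<Rightarrow> (nat \<Rightarrow> complex) \<Rightarrow> nat \<Rightarrow> bool" where
  "row_convergent A x n \<longleftrightarrow> summable (\<lambda>k. A n (Suc k) * x (Suc k))"

definition mat_transform :: "(nat \<Rightarrow> nat \<Rightarrow> complex) \<Rightarrow> (nat \<Rightarrow> complex) \<Rightarrow> nat \<Rightarrow> complex" where
  "mat_transform A x = (\<lambda>n. if n = 0 then 0 else (\<Sum>k. A n (Suc k) * x (Suc k)))"

definition mat_class ::
    "(nat \<Rightarrow> complex) set \<Rightarrow> (nat \<Rightarrow> complex) set \<Rightarrow> (nat \<Rightarrow> nat \<Rightarrow> complex) set" where
  "mat_class X Y =
     {A. \<forall>x\<in>X. (\<forall>n\<ge>1. row_convergent A x n) \<and> mat_transform A x \<in> Y}"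

end

theory Submission
  imports Defs
begin

text \<open>
  Row \<open>n\<close> of \<open>M\<close> is a combination of rows \<open>n\<close> and \<open>n - 1\<close> of \<open>A\<close>, and by induction row \<open>n\<close> of
  \<open>A\<close> is a combination of the first \<open>n\<close> rows of \<open>M\<close>. Hence \<open>Ax\<close> exists iff \<open>Mx\<close> exists, and then
  \<open>Mx\<close> is the sequence of differences whose absolute summability defines \<open>Ax \<in> d(bv)\<close>.
  The case distinction for the first row is absorbed by \<open>inverse 0 = 0\<close>.
\<close>

lemma row_convergent_difference_iff:
  assumes m: "\<And>n k. k \<ge> 1 \<Longrightarrow>
      m (Suc n) k = inverse (of_nat (Suc n)) * a (Suc n) k - inverse (of_nat n) * a n k"
  shows "(\<forall>n\<ge>1. row_convergent a x n) \<longleftrightarrow> (\<forall>n\<ge>1. row_convergent m x n)"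
proof
  assume a: "\<forall>n\<ge>1. row_convergent a x n"
  \<comment> \<open>At n = 0 the factor \<open>inverse 0 = 0\<close> annihilates row 0 of
    \<open>a\<close>, about which nothing is known.\<close>
  have scaled: "summable (\<lambda>k. inverse (of_nat n) * (a n (Suc k) * x (Suc k)))" for n
    using a by (cases "n = 0") (auto simp: row_convergent_def intro!: summable_mult)
  have "row_convergent m x (Suc n)" for n
    using summable_diff[OF scaled[of "Suc n"] scaled[of n]]
    by (simp add: row_convergent_def m left_diff_distrib mult.assoc del: of_nat_Suc)
  then show "\<forall>n\<ge>1. row_convergent m x n"
    by (metis One_nat_def Suc_le_D)
next
  assume "\<forall>n\<ge>1. row_convergent m x n"
  then have m_conv: "summable (\<lambda>k. m (Suc n) (Suc k) * x (Suc k))" for n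
    by (simp add: row_convergent_def)
  \<comment> \<open>Dividing row n by n makes the recurrence telescope: row \<open>Suc n\<close> of
    \<open>m\<close> is exactly the increment between consecutive scaled rows.\<close>
  have scaled: "summable (\<lambda>k. inverse (of_nat n) * (a n (Suc k) * x (Suc k)))" for n
  proof (induction n)
    case 0
    then show ?case by simp
  next
    case (Suc n)
    from summable_add[OF m_conv[of n] Suc] show ?case
      by (simp add: m algebra_simps)
  qed
  show "\<forall>n\<ge>1. row_convergent a x n"
  proof (intro allI impI)
    fix n :: nat
    assume "n \<ge> 1"
    \<comment> \<open>For n \<ge> 1 the factor \<open>inverse (of_nat n)\<close> is nonzero and
      cancels.\<close>
    then show "row_convergent a x n"
      using scaled[of n] by (simp add: row_convergent_def summable_cmult_iff)
  qed
qed

lemma mat_transform_difference: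
  assumes m: "\<And>n k. k \<ge> 1 \<Longrightarrow>
      m (Suc n) k = inverse (of_nat (Suc n)) * a (Suc n) k - inverse (of_nat n) * a n k"
    and conv: "\<forall>n\<ge>1. row_convergent a x n"
  shows "mat_transform m x (Suc n) =
      inverse (of_nat (Suc n)) * mat_transform a x (Suc n)
      - inverse (of_nat n) * mat_transform a x n"
proof -
  have "(\<lambda>k. inverse (of_nat n) * (a n (Suc k) * x (Suc k)))
      sums (inverse (of_nat n) * mat_transform a x n)" for n
    using conv
    by (cases "n = 0")
      (auto simp: row_convergent_def mat_transform_def intro!: sums_mult summable_sums)
  from sums_diff[OF this[of "Suc n"] this[of n]] show ?thesis
    by (simp add: mat_transform_def m sums_iff algebra_simps)
qed

lemma in_d_bv_iff_difference_in_ell1: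
  assumes "x 0 = 0" "y 0 = 0"
    and y: "\<And>n. y (Suc n) = inverse (of_nat (Suc n)) * x (Suc n) - inverse (of_nat n) * x n"
  shows "x \<in> d_bv \<longleftrightarrow> y \<in> ell1"
proof -
  have "y k = (if k = 1 then x 1
      else inverse (of_nat k) * x k - inverse (of_nat (k - 1)) * x (k - 1))"
    if "k \<in> {1..}" for k
    \<comment> \<open>For k = 1 the subtracted term is \<open>inverse 0 * x 0\<close>, which leaves
      \<open>x 1\<close>.\<close>
    using that y[of "k - 1"] by auto
  then have "(\<lambda>k. cmod (y k)) summable_on {1..} \<longleftrightarrow>
      (\<lambda>k. cmod (if k = 1 then x 1
         else inverse (of_nat k) * x k - inverse (of_nat (k - 1)) * x (k - 1))) summable_on {1..}"
    by (intro summable_on_cong) simp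
  with assms(1,2) show ?thesis
    by (simp add: d_bv_def ell1_def omega_def)
qed

theorem theorem4p5:
  fixes Y :: "(nat \<Rightarrow> complex) set"
    and a m :: "nat \<Rightarrow> nat \<Rightarrow> complex"
  assumes "sequence_space Y"
    and "\<And>n k. n \<ge> 1 \<Longrightarrow> k \<ge> 1 \<Longrightarrow>
      m n k = (if n = 1 then a 1 k
               else inverse (of_nat n) * a n k - inverse (of_nat (n - 1)) * a (n - 1) k)"
  shows "a \<in> mat_class Y d_bv \<longleftrightarrow> m \<in> mat_class Y ell1"
proof -
  have m: "m (Suc n) k = inverse (of_nat (Suc n)) * a (Suc n) k - inverse (of_nat n) * a n k"
    if "k \<ge> 1" for n k
    using assms(2)[of "Suc n" k] that by auto
  \<comment> \<open>Row convergence is required here because \<open>suminf\<close> of a divergent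
    series carries no information. With the equivalence of convergence below, the two conditions in
    \<open>mat_class\<close> agree for each x separately.\<close>
  have "mat_transform a x \<in> d_bv \<longleftrightarrow> mat_transform m x \<in> ell1"
    if "\<forall>n\<ge>1. row_convergent a x n" for x
    using mat_transform_difference[OF m that]
    by (intro in_d_bv_iff_difference_in_ell1) (simp_all add: mat_transform_def)
  moreover have "(\<forall>n\<ge>1. row_convergent a x n) \<longleftrightarrow> (\<forall>n\<ge>1. row_convergent m x n)" for x
    using row_convergent_difference_iff m by blast
  ultimately show ?thesis
    unfolding mat_class_def by blast
qed

end
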